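(* Let $P$ be a crowned section. There exists a retraction of $P$ onto a 4-crown stack if and only if at least one of the following holds: (a) there exists a retractive down-split $(k,D,s,t)$ of $P$, with $S = s[P(k+1\to h_P)\setminus D]$ and $T = t[P(0\to k)]$, for which $T(h_T) < S(0)$ and for which the mapping $$p \mapsto \begin{cases} s(p), & \text{if } p \in P(k+1\to h_P)\setminus D,\\ t(p), & \text{if } p \in P(0\to k)\end{cases}$$ can be extended to a retraction $r : P \to T \oplus S$; (b) there exists a retractive up-split $(k,U,s,t)$ of $P$, with $S = s[P(0\to k-1)\setminus U]$ and $T = t[P(k\to h_P)]$, for which $S(h_S) < T(0)$ and for which the mapping $$p \mapsto \begin{cases} s(p), & \text{if } p \in P(0\to k-1)\setminus U,\\ t(p), & \text{if } p \in P(k\to h_P)\end{cases}$$ can be extended to a retraction $r : P \to S \oplus T$.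
   Context: All posets are finite. $[i,j] = \{i,\dots,j\}$ for integers. The height $h_P$ of a poset $P$ is the maximal length (cardinality minus one) of a chain in $P$. Level sets: $P(0) := \min P$ and $P(k+1) := \min(P \setminus \bigcup_{i=0}^k P(i))$ for $0 \le k < h_P$. For $k \le \ell$, $P(k,\ell) := P(k) \cup P(\ell)$ and $P(k\to\ell) := \bigcup_{i=k}^{\ell} P(i)$; subsets are identified with the induced sub-posets. $A < B$ means $a < b$ for all $a \in A$, $b \in B$. A retraction of a poset $Q$ onto an induced sub-poset $R$ is an idempotent order-preserving map $r : Q \to Q$ with image $R$. $\oplus$ denotes the ordinal sum; if $T(h_T) < S(0)$ in $P$, then $T\oplus S$ is the sub-poset of $P$ induced on $T \cup S$ (and similarly for $S \oplus T$). For $n \geq 2$, a $2n$-crown is a poset with $2n$ points $x_{i,j}$, $i \in [0,n-1]$, $j \in \{0,1\}$, whose only comparabilities between different points are $x_{0,0} < x_{0,1} > x_{1,0} < \cdots > x_{n-1,0} < x_{n-1,1} > x_{0,0}$. A 4-crown stack is a poset $R$ of height at least 1 such that $R(k,k+1)$ is a 4-crown for all $k \in [0,h_R-1]$, all other comparabilities being induced by transitivity. A poset is of type $33$ if it is the ordinal sum of two 3-element antichains. A section of width three is a poset $P$ of height at least one with carrier $\{c_{k,j} : k \in [0,h_P], j \in \{0,1,2\}\}$ such that: $c_{0,j} < \cdots < c_{h_P,j}$ is a chain for each $j$; $\{c_{k,0},c_{k,1},c_{k,2}\}$ is an antichain for each $k$; the map $c_{k,j} \mapsto c_{k,(j+1)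 \bmod 3}$ is an automorphism of $P$; and $P(k,k+1) \not\simeq 33$ for all $k \in [0,h_P-1]$. A crowned section is a section $P$ of width three for which $P(0,1)$ and $P(h_P-1,h_P)$ are 6-crowns. A retractive down-split of a crowned section $P$ is a quadruple $(k,D,s,t)$ with $k \in [0,h_P-1]$, $D \subset P(k+1 \to h_P)$ a (possibly empty) down-set of $P(k+1\to h_P)$, $s : P(k+1\to h_P)\setminus D \to S$ a retraction and $t : P(0\to k) \to T$ a retraction, where each of $S$ and $T$ is a 2-element antichain or a 4-crown stack. A retractive up-split of $P$ is a quadruple $(k,U,s,t)$ with $k \in [1,h_P]$, $U \subset P(0\to k-1)$ a (possibly empty) up-set of $P(0 \to k-1)$, $s : P(0\to k-1)\setminus U \to S$ a retraction and $t : P(k \to h_P) \to T$ a retraction, where each of $S$ and $T$ is a 2-element antichain or a 4-crown stack. *)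

theory Defs
  imports Main
begin

text \<open>
  A finite poset is a finite carrier \<open>P\<close> with its reflexive order relation \<open>r\<close>
  (\<open>partial_order_on P r\<close>).  A subset \<open>A\<close> of \<open>P\<close> stands for the sub-poset induced on it:
  every notion below takes \<open>r\<close> together with a carrier \<open>A\<close> and depends only on the
  restriction of \<open>r\<close> to \<open>A\<close>.  In particular heights and level sets of a sub-poset are computed
  inside the sub-poset.
\<close>

definition lt :: "'a rel \<Rightarrow> 'a \<Rightarrow> 'a \<Rightarrow> bool" where
  "lt r x y \<longleftrightarrow> (x, y) \<in> r \<and> x \<noteq> y"

definition set_lt :: "'a rel \<Rightarrow> 'a set \<Rightarrow> 'a set \<Rightarrow> bool" where
  "set_lt r A B \<longleftrightarrow> (\<forall>a\<in>A. \<forall>b\<in>B. lt r a b)"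

definition antichain_in :: "'a rel \<Rightarrow> 'a set \<Rightarrow> bool" where
  "antichain_in r A \<longleftrightarrow> (\<forall>a\<in>A. \<forall>b\<in>A. \<not> lt r a b)"

text \<open>Chains are counted with cardinality minus one; the (irrelevant) empty poset gets height 0.\<close>

definition height :: "'a rel \<Rightarrow> 'a set \<Rightarrow> nat" where
  "height r A = Max (card ` {C. C \<subseteq> A \<and> C \<in> Chains r}) - 1"

definition minimals :: "'a rel \<Rightarrow> 'a set \<Rightarrow> 'a set" where
  "minimals r A = {x\<in>A. \<forall>y\<in>A. \<not> lt r y x}"

text \<open>For \<open>k\<close> beyond the height of \<open>A\<close> the set \<open>level r A k\<close> is empty.\<close>

function level :: "'a rel \<Rightarrow> 'a set \<Rightarrow> nat \<Rightarrow> 'a set" where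
  "level r A k = minimals r (A - (\<Union>i\<in>{..<k}. level r A i))"
  by pat_completeness auto
termination by (relation "measure (\<lambda>(_, _, k). k)") auto

declare level.simps [simp del]

definition level2 :: "'a rel \<Rightarrow> 'a set \<Rightarrow> nat \<Rightarrow> nat \<Rightarrow> 'a set" where
  "level2 r A k l = level r A k \<union> level r A l"

definition levels :: "'a rel \<Rightarrow> 'a set \<Rightarrow> nat \<Rightarrow> nat \<Rightarrow> 'a set" where
  "levels r A k l = (\<Union>i\<in>{k..l}. level r A i)"

definition down_set_of :: "'a rel \<Rightarrow> 'a set \<Rightarrow> 'a set \<Rightarrow> bool" where
  "down_set_of r Q D \<longleftrightarrow> D \<subseteq> Q \<and> (\<forall>x\<in>D. \<forall>y\<in>Q. (y, x) \<in> r \<longrightarrow> y \<in> D)"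

definition up_set_of :: "'a rel \<Rightarrow> 'a set \<Rightarrow> 'a set \<Rightarrow> bool" where
  "up_set_of r Q U \<longleftrightarrow> U \<subseteq> Q \<and> (\<forall>x\<in>U. \<forall>y\<in>Q. (x, y) \<in> r \<longrightarrow> y \<in> U)"

text \<open>Only the values of \<open>f\<close> on \<open>Q\<close> matter.\<close>

definition retraction_onto :: "'a rel \<Rightarrow> 'a set \<Rightarrow> 'a set \<Rightarrow> ('a \<Rightarrow> 'a) \<Rightarrow> bool" where
  "retraction_onto r Q R f \<longleftrightarrow>
     R \<subseteq> Q \<and> f ` Q = R \<and> (\<forall>x\<in>Q. f (f x) = f x) \<and>
     monotone_on Q (\<lambda>x y. (x, y) \<in> r) (\<lambda>x y. (x, y) \<in> r) f"

definition automorphism_of :: "'a rel \<Rightarrow> 'a set \<Rightarrow> ('a \<Rightarrow> 'a) \<Rightarrow> bool" where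
  "automorphism_of r A f \<longleftrightarrow>
     bij_betw f A A \<and> (\<forall>x\<in>A. \<forall>y\<in>A. (x, y) \<in> r \<longleftrightarrow> (f x, f y) \<in> r)"

text \<open>\<open>crown n r A\<close>: \<open>A\<close> is a \<open>2n\<close>-crown, with points \<open>x i j\<close> for \<open>i < n\<close> and \<open>j \<in> {0, 1}\<close>;
  \<open>x i' 1\<close> has exactly the lower neighbours \<open>x i' 0\<close> and \<open>x ((i' + 1) mod n) 0\<close>.\<close>

definition crown :: "nat \<Rightarrow> 'a rel \<Rightarrow> 'a set \<Rightarrow> bool" where
  "crown n r A \<longleftrightarrow> n \<ge> 2 \<and>
     (\<exists>x :: nat \<Rightarrow> nat \<Rightarrow> 'a.
        bij_betw (\<lambda>(i, j). x i j) ({..<n} \<times> {0, 1}) A \<and>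
        (\<forall>i<n. \<forall>j\<in>{0, 1}. \<forall>i'<n. \<forall>j'\<in>{0, 1}.
           lt r (x i j) (x i' j') \<longleftrightarrow>
             j = 0 \<and> j' = 1 \<and> (i = i' \<or> i = (i' + 1) mod n)))"

text \<open>The last condition says that the order of \<open>R\<close> is generated, through transitivity, by the
  orders of its sub-posets on two consecutive levels.\<close>

definition four_crown_stack :: "'a rel \<Rightarrow> 'a set \<Rightarrow> bool" where
  "four_crown_stack r R \<longleftrightarrow>
     finite R \<and> height r R \<ge> 1 \<and>
     (\<forall>k<height r R. crown 2 r (level2 r R k (k + 1))) \<and>
     r \<inter> R \<times> R =
       (\<Union>k<height r R. r \<inter> level2 r R k (k + 1) \<times> level2 r R k (k + 1))\<^sup>+"

definition type33 :: "'a rel \<Rightarrow> 'a set \<Rightarrow> bool" where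
  "type33 r Q \<longleftrightarrow>
     (\<exists>A B. Q = A \<union> B \<and> card A = 3 \<and> card B = 3 \<and>
        antichain_in r A \<and> antichain_in r B \<and> set_lt r A B)"

text \<open>The carrier of a section consists of \<open>3 * (height r P + 1)\<close> different points \<open>c k j\<close>.\<close>

definition width_three_section :: "'a rel \<Rightarrow> 'a set \<Rightarrow> bool" where
  "width_three_section r P \<longleftrightarrow>
     finite P \<and> partial_order_on P r \<and> height r P \<ge> 1 \<and>
     (\<exists>c :: nat \<Rightarrow> nat \<Rightarrow> 'a.
        bij_betw (\<lambda>(k, j). c k j) ({0..height r P} \<times> {0, 1, 2}) P \<and>
        (\<forall>j\<in>{0, 1, 2}. \<forall>k<height r P. lt r (c k j) (c (k + 1) j)) \<and>
        (\<forall>k\<le>height r P. antichain_in r {c k 0, c k 1, c k 2}) \<and>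
        (\<exists>f. automorphism_of r P f \<and>
             (\<forall>k\<le>height r P. \<forall>j\<in>{0, 1, 2}. f (c k j) = c k ((j + 1) mod 3)))) \<and>
     (\<forall>k<height r P. \<not> type33 r (level2 r P k (k + 1)))"

definition crowned_section :: "'a rel \<Rightarrow> 'a set \<Rightarrow> bool" where
  "crowned_section r P \<longleftrightarrow>
     width_three_section r P \<and>
     crown 3 r (level2 r P 0 1) \<and>
     crown 3 r (level2 r P (height r P - 1) (height r P))"

definition split_target :: "'a rel \<Rightarrow> 'a set \<Rightarrow> bool" where
  "split_target r S \<longleftrightarrow> (card S = 2 \<and> antichain_in r S) \<or> four_crown_stack r S"

text \<open>The targets \<open>S\<close> and \<open>T\<close> are not part of the quadruples: they are the images of \<open>s\<close>
  and \<open>t\<close>.\<close>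

definition retractive_down_split ::
  "'a rel \<Rightarrow> 'a set \<Rightarrow> nat \<Rightarrow> 'a set \<Rightarrow> ('a \<Rightarrow> 'a) \<Rightarrow> ('a \<Rightarrow> 'a) \<Rightarrow> bool" where
  "retractive_down_split r P k D s t \<longleftrightarrow>
     k < height r P \<and>
     down_set_of r (levels r P (k + 1) (height r P)) D \<and>
     (\<exists>S T. split_target r S \<and> split_target r T \<and>
        retraction_onto r (levels r P (k + 1) (height r P) - D) S s \<and>
        retraction_onto r (levels r P 0 k) T t)"

definition retractive_up_split ::
  "'a rel \<Rightarrow> 'a set \<Rightarrow> nat \<Rightarrow> 'a set \<Rightarrow> ('a \<Rightarrow> 'a) \<Rightarrow> ('a \<Rightarrow> 'a) \<Rightarrow> bool" where
  "retractive_up_split r P k U s t \<longleftrightarrow>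
     1 \<le> k \<and> k \<le> height r P \<and>
     up_set_of r (levels r P 0 (k - 1)) U \<and>
     (\<exists>S T. split_target r S \<and> split_target r T \<and>
        retraction_onto r (levels r P 0 (k - 1) - U) S s \<and>
        retraction_onto r (levels r P k (height r P)) T t)"

end

theory Submission
  imports Defs
begin

text \<open>
  A 4-crown is the ordinal sum of two 2-element antichains, so a 4-crown stack is the ordinal
  sum \<open>L 0 \<oplus> \<dots> \<oplus> L m\<close> of \<open>m + 1 \<ge> 2\<close> such antichains (\<open>pair_tower\<close>;
  \<open>four_crown_stack_imp_tower\<close> and \<open>tower_imp_four_crown_stack\<close>), and the targets of a split are
  the towers with \<open>m \<ge> 0\<close>.  Stacking one tower on another gives a tower with at least two
  storeys.  This settles the direction from the splits to the retraction: the extended map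
  retracts \<open>P\<close> onto a 4-crown stack by hypothesis.

  Conversely, a retraction \<open>f\<close> onto a tower can be changed so that it splits at the lowest
  possible place, between \<open>min P\<close> and the rest.  Let \<open>L 0 = {a, b}\<close>.  A minimal point of
  \<open>P\<close> below \<open>a\<close> has its image below \<open>a\<close>, hence equal to \<open>a\<close>; so \<open>a\<close> and \<open>b\<close>
  may be replaced by minimal points \<open>a'\<close> and \<open>b'\<close> of \<open>P\<close>.  A minimal point of \<open>P\<close>
  that \<open>f\<close> sends to a higher storey may be sent to \<open>a'\<close> instead: nothing lies below it, and all
  points above it have their images above \<open>L 0\<close>.  The new retraction \<open>g\<close> maps \<open>min P\<close> onto
  \<open>{a', b'}\<close> (\<open>retraction_with_minimal_bottom\<close>).  With \<open>k = 0\<close> and \<open>D\<close> the set of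
  non-minimal points that \<open>g\<close> sends to \<open>{a', b'}\<close>, this is a down-split as in the first
  alternative, whose extension is \<open>g\<close> itself.
\<close>

section \<open>Strict order and level sets of finite posets\<close>

lemma lt_trans:
  assumes "partial_order_on P r" "lt r x y" "lt r y z"
  shows "lt r x z"
  using assms unfolding lt_def partial_order_on_def preorder_on_def
  by (metis antisymD transD)

lemma lt_asym:
  assumes "partial_order_on P r" "lt r x y"
  shows "\<not> lt r y x"
  using assms unfolding lt_def partial_order_on_def by (metis antisymD)

lemma le_iff_lt_or_eq:
  assumes "partial_order_on P r" "x \<in> P"
  shows "(x, y) \<in> r \<longleftrightarrow> lt r x y \<or> x = y"
  using assms unfolding lt_def partial_order_on_def preorder_on_def
  by (auto dest: refl_onD)

lemma level_0: "level r A 0 = minimals r A"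
  by (subst level.simps) simp

text \<open>A point outside the first \<open>k + 1\<close> levels is not minimal among the points outside the first
  \<open>k\<close> levels; a witness for this continues the chain downwards.  Applied to \<open>k = height r P + 1\<close>
  this shows that the levels up to the height exhaust \<open>P\<close>.\<close>

lemma chain_below_high_point:
  assumes po: "partial_order_on P r"
    and "x \<in> P - (\<Union>i<k. level r P i)"
  shows "\<exists>C. C \<subseteq> P \<and> C \<in> Chains r \<and> finite C \<and> card C = k + 1 \<and> x \<in> C
    \<and> (\<forall>y\<in>C. (y, x) \<in> r)"
  using assms(2)
proof (induction k arbitrary: x)
  case 0
  then have "(x, x) \<in> r" using le_iff_lt_or_eq[OF po] by blast
  with 0 show ?case by (intro exI[of _ "{x}"]) (auto simp: Chains_def)
next
  case (Suc k)
  let ?A = "P - (\<Union>i<k. level r P i)"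
  have x: "x \<in> ?A" "x \<notin> level r P k" "x \<in> P" using Suc.prems by (auto simp: less_Suc_eq)
  then obtain y where y: "y \<in> ?A" "lt r y x"
    by (subst (asm) (2) level.simps) (auto simp: minimals_def)
  from Suc.IH[OF y(1)] obtain C where C: "C \<subseteq> P" "C \<in> Chains r" "finite C" "card C = k + 1"
    "\<forall>z\<in>C. (z, y) \<in> r" by blast
  have lt: "lt r z x" if "z \<in> C" for z
    using C that y(2) lt_trans[OF po _ y(2)] le_iff_lt_or_eq[OF po] by blast
  then have "x \<notin> C" by (auto simp: lt_def)
  have "(x, x) \<in> r" using x le_iff_lt_or_eq[OF po] by blast
  with lt C \<open>x \<notin> C\<close> x show ?case
    by (intro exI[of _ "insert x C"]) (auto simp: Chains_def lt_def)
qed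

lemma card_chain_le_height:
  assumes "finite A" "C \<subseteq> A" "C \<in> Chains r"
  shows "card C \<le> height r A + 1"
proof -
  have "card C \<le> Max (card ` {C. C \<subseteq> A \<and> C \<in> Chains r})"
    using assms by (intro Max_ge) auto
  then show ?thesis unfolding height_def by simp
qed

lemma levels_cover:
  assumes "partial_order_on P r" "finite P"
  shows "levels r P 0 (height r P) = P"
proof
  have "level r P k \<subseteq> P" for k by (subst level.simps) (auto simp: minimals_def)
  then show "levels r P 0 (height r P) \<subseteq> P" unfolding levels_def by blast
next
  show "P \<subseteq> levels r P 0 (height r P)"
  proof
    fix x assume "x \<in> P"
    show "x \<in> levels r P 0 (height r P)"
    proof (rule ccontr)
      assume "x \<notin> levels r P 0 (height r P)"
      with \<open>x \<in> P\<close> have "x \<in> P - (\<Union>i<height r P + 1. level r P i)"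
        by (force simp: levels_def)
      from chain_below_high_point[OF assms(1) this]
      obtain C where "C \<subseteq> P" "C \<in> Chains r" "card C = height r P + 1 + 1" by blast
      with card_chain_le_height[OF assms(2), of C r] show False by simp
    qed
  qed
qed

lemma levels_0_0: "levels r P 0 0 = minimals r P"
  by (simp add: levels_def level_0)

lemma levels_from_1:
  assumes "partial_order_on P r" "finite P"
  shows "levels r P 1 (height r P) = P - minimals r P"
proof -
  have "level r P i \<inter> minimals r P = {}" if "i \<ge> 1" for i
  proof -
    have "level r P i \<subseteq> P - (\<Union>j<i. level r P j)" by (subst level.simps) (auto simp: minimals_def)
    moreover have "0 < i" using that by simp
    ultimately show ?thesis using level_0[of r P] by blast
  qed
  then have "levels r P 1 (height r P) \<inter> minimals r P = {}" unfolding levels_def by fastforce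
  moreover have "levels r P 0 (height r P) = minimals r P \<union> levels r P 1 (height r P)"
  proof -
    have "{0..height r P} = insert 0 {1..height r P}" by auto
    then show ?thesis by (simp add: levels_def level_0)
  qed
  ultimately show ?thesis using levels_cover[OF assms] by auto
qed

lemma exists_minimal_below:
  assumes po: "partial_order_on P r" and "finite P" "x \<in> P"
  shows "\<exists>y\<in>minimals r P. (y, x) \<in> r"
proof -
  let ?Q = "\<lambda>y. y \<in> P \<and> (y, x) \<in> r"
  \<comment> \<open>Among the points below \<open>x\<close>, one with the fewest points below itself is minimal.\<close>
  let ?down = "\<lambda>y. {z\<in>P. (z, y) \<in> r}"
  have "?Q x" using assms le_iff_lt_or_eq[OF po] by blast
  then obtain y where y: "?Q y" and least: "\<And>z. ?Q z \<Longrightarrow> card (?down y) \<le> card (?down z)"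
    using ex_has_least_nat[of ?Q x "\<lambda>y. card (?down y)"] by blast
  have "\<not> lt r z y" if "z \<in> P" for z
  proof
    assume z: "lt r z y"
    have tr: "trans r" using po unfolding partial_order_on_def preorder_on_def by blast
    have "?Q z" using that z y tr unfolding lt_def by (blast dest: transD)
    moreover have "?down z \<subset> ?down y"
    proof
      show "?down z \<subseteq> ?down y" using z tr unfolding lt_def by (blast dest: transD)
      have "y \<in> ?down y" using y le_iff_lt_or_eq[OF po] by blast
      moreover have "y \<notin> ?down z" using z lt_asym[OF po z] unfolding lt_def by blast
      ultimately show "?down z \<noteq> ?down y" by blast
    qed
    then have "card (?down z) < card (?down y)" using \<open>finite P\<close> by (intro psubset_card_mono) auto
    ultimately show False using least by fastforce
  qed
  with y show ?thesis unfolding minimals_def by blast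
qed

section \<open>Towers of two-element antichains\<close>

text \<open>The storeys are given as a family rather than as the levels of their union, so that storeys can
  be replaced, shifted or concatenated without recomputing levels; the levels of the union are
  recovered in \<open>level_pair_tower\<close>.\<close>

definition pair_tower :: "'a rel \<Rightarrow> nat \<Rightarrow> (nat \<Rightarrow> 'a set) \<Rightarrow> bool" where
  "pair_tower r m L \<longleftrightarrow>
     (\<forall>i\<le>m. card (L i) = 2 \<and> antichain_in r (L i)) \<and>
     (\<forall>j\<le>m. \<forall>i<j. set_lt r (L i) (L j))"

lemma pair_tower_ltD:
  "pair_tower r m L \<Longrightarrow> i < j \<Longrightarrow> j \<le> m \<Longrightarrow> x \<in> L i \<Longrightarrow> y \<in> L j \<Longrightarrow> lt r x y"
  unfolding pair_tower_def set_lt_def by blast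

lemma pair_tower_antichain:
  "pair_tower r m L \<Longrightarrow> i \<le> m \<Longrightarrow> x \<in> L i \<Longrightarrow> y \<in> L i \<Longrightarrow> \<not> lt r x y"
  unfolding pair_tower_def antichain_in_def by blast

lemma pair_tower_nonempty: "pair_tower r m L \<Longrightarrow> i \<le> m \<Longrightarrow> \<exists>x. x \<in> L i"
  unfolding pair_tower_def card_2_iff by blast

lemma pair_tower_finite: "pair_tower r m L \<Longrightarrow> finite (\<Union>i\<le>m. L i)"
  unfolding pair_tower_def by (metis card.infinite finite_UN_I finite_atMost atMost_iff zero_neq_numeral)

lemma pair_tower_lt_iff:
  assumes "partial_order_on P r" "pair_tower r m L" "i \<le> m" "j \<le> m" "x \<in> L i" "y \<in> L j"
  shows "lt r x y \<longleftrightarrow> i < j"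
proof (cases i j rule: linorder_cases)
  case less
  then show ?thesis using pair_tower_ltD[OF assms(2) less] assms by simp
next
  case equal
  then show ?thesis using pair_tower_antichain[OF assms(2,3)] assms by simp
next
  case greater
  then show ?thesis using lt_asym[OF assms(1) pair_tower_ltD[OF assms(2) greater]] assms by simp
qed

lemma pair_tower_disjoint:
  assumes "pair_tower r m L" "i \<le> m" "j \<le> m" "x \<in> L i" "x \<in> L j"
  shows "i = j"
  using pair_tower_ltD[OF assms(1), of i j x x] pair_tower_ltD[OF assms(1), of j i x x] assms
  by (cases i j rule: linorder_cases) (auto simp: lt_def)

lemma level_pair_tower:
  assumes po: "partial_order_on P r" and tow: "pair_tower r m L" and "k \<le> m"
  shows "level r (\<Union>i\<le>m. L i) k = L k"
  using \<open>k \<le> m\<close>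
proof (induction k rule: less_induct)
  case (less k)
  let ?R = "\<Union>i\<le>m. L i"
  have "level r ?R k = minimals r (?R - (\<Union>i<k. L i))"
    using less by (subst level.simps) simp
  also have "?R - (\<Union>i<k. L i) = (\<Union>i\<in>{k..m}. L i)"
  proof -
    have "{..m} = {..<k} \<union> {k..m}" using less.prems by auto
    moreover have "(\<Union>i<k. L i) \<inter> (\<Union>i\<in>{k..m}. L i) = {}"
    proof -
      have False if "i < k" "x \<in> L i" "k \<le> j" "j \<le> m" "x \<in> L j" for i j x
        using pair_tower_ltD[OF tow, of i j x x] that by (auto simp: lt_def)
      then show ?thesis by auto
    qed
    ultimately show ?thesis by (simp add: UN_Un Un_Diff Diff_triv Int_commute)
  qed
  also have "minimals r \<dots> = L k"
  proof -
    obtain z where "z \<in> L k" using pair_tower_nonempty[OF tow less.prems] by blast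
    show ?thesis
    proof
      show "minimals r (\<Union>i\<in>{k..m}. L i) \<subseteq> L k"
      proof
        fix x assume x: "x \<in> minimals r (\<Union>i\<in>{k..m}. L i)"
        then obtain i where i: "i \<in> {k..m}" "x \<in> L i" by (auto simp: minimals_def)
        have "\<not> lt r z x" using x \<open>z \<in> L k\<close> less.prems by (auto simp: minimals_def)
        then have "\<not> k < i" using pair_tower_ltD[OF tow, of k i z x] i \<open>z \<in> L k\<close> by auto
        then show "x \<in> L k" using i by auto
      qed
      show "L k \<subseteq> minimals r (\<Union>i\<in>{k..m}. L i)"
      proof
        fix x assume "x \<in> L k"
        moreover have "\<not> lt r y x" if "i \<in> {k..m}" "y \<in> L i" for i y
          using that less.prems \<open>x \<in> L k\<close> pair_tower_lt_iff[OF po tow, of i k y x] by simp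
        ultimately show "x \<in> minimals r (\<Union>i\<in>{k..m}. L i)"
          using less.prems unfolding minimals_def by auto
      qed
    qed
  qed
  finally show ?case .
qed

lemma height_pair_tower:
  assumes po: "partial_order_on P r" and tow: "pair_tower r m L" and sub: "(\<Union>i\<le>m. L i) \<subseteq> P"
  shows "height r (\<Union>i\<le>m. L i) = m"
proof (rule antisym)
  let ?R = "\<Union>i\<le>m. L i"
  note fin = pair_tower_finite[OF tow]
  \<comment> \<open>A chain meets every storey at most once.\<close>
  have "card C \<le> m + 1" if C: "C \<subseteq> ?R" "C \<in> Chains r" for C
  proof -
    from C(1) have "\<forall>x\<in>C. \<exists>i. i \<le> m \<and> x \<in> L i" by blast
    then obtain idx where idx: "\<And>x. x \<in> C \<Longrightarrow> idx x \<le> m \<and> x \<in> L (idx x)" by metis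
    have "inj_on idx C"
    proof (rule inj_onI)
      fix x y assume xy: "x \<in> C" "y \<in> C" "idx x = idx y"
      with C(2) have "(x, y) \<in> r \<or> (y, x) \<in> r" by (auto simp: Chains_def)
      with xy idx pair_tower_antichain[OF tow] show "x = y" unfolding lt_def by metis
    qed
    then have "card C \<le> card {..m}" using idx by (intro card_inj_on_le[of idx]) auto
    then show ?thesis by simp
  qed
  then have "Max (card ` {C. C \<subseteq> ?R \<and> C \<in> Chains r}) \<le> m + 1"
    using fin by (subst Max_le_iff) (auto intro!: exI[of _ "{}"] simp: Chains_def)
  then show "height r ?R \<le> m" unfolding height_def by simp
  obtain p where p: "\<And>i. i \<le> m \<Longrightarrow> p i \<in> L i" using pair_tower_nonempty[OF tow] by metis
  have "(p i, p j) \<in> r \<or> (p j, p i) \<in> r" if "i \<le> m" "j \<le> m" for i j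
  proof -
    have "p i \<in> P" using p sub that by blast
    then show ?thesis
      using p that pair_tower_ltD[OF tow] le_iff_lt_or_eq[OF po] unfolding lt_def
      by (metis linorder_neqE_nat)
  qed
  then have "p ` {..m} \<in> Chains r" by (auto simp: Chains_def)
  moreover have "inj_on p {..m}"
    using p pair_tower_disjoint[OF tow] by (intro inj_onI) (metis atMost_iff)
  then have "card (p ` {..m}) = m + 1" by (simp add: card_image)
  ultimately show "m \<le> height r ?R"
    using card_chain_le_height[OF fin, of "p ` {..m}" r] p by auto
qed

text \<open>For \<open>n = 2\<close> the cyclic condition on the indices of a crown holds for every pair, so every
  bottom point lies below every top point.\<close>

lemma crown_2_iff:
  "crown 2 r A \<longleftrightarrow> (\<exists>a b c d. A = {a, b, c, d} \<and> distinct [a, b, c, d] \<and>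
     (\<forall>x\<in>A. \<forall>y\<in>A. lt r x y \<longleftrightarrow> x \<in> {a, b} \<and> y \<in> {c, d}))"
proof
  assume "crown 2 r A"
  then obtain x :: "nat \<Rightarrow> nat \<Rightarrow> 'a" where
    bij: "bij_betw (\<lambda>(i, j). x i j) ({..<2} \<times> {0, 1}) A" and
    ord: "\<And>i j i' j'. \<lbrakk>i < 2; j \<in> {0, 1}; i' < 2; j' \<in> {0, 1}\<rbrakk> \<Longrightarrow>
      lt r (x i j) (x i' j') \<longleftrightarrow> j = 0 \<and> j' = 1 \<and> (i = i' \<or> i = (i' + 1) mod 2)"
    unfolding crown_def by auto
  have dom: "{..<2} \<times> {0, 1} = {(0::nat, 0::nat), (1, 0), (0, 1), (1, 1)}"
    by (auto simp: less_2_cases_iff)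
  have A: "A = {x 0 0, x 1 0, x 0 1, x 1 1}"
    using bij unfolding bij_betw_def dom by auto
  have "distinct [x 0 0, x 1 0, x 0 1, x 1 1]"
    using bij unfolding bij_betw_def dom inj_on_def by auto
  with A show "\<exists>a b c d. A = {a, b, c, d} \<and> distinct [a, b, c, d] \<and>
     (\<forall>x\<in>A. \<forall>y\<in>A. lt r x y \<longleftrightarrow> x \<in> {a, b} \<and> y \<in> {c, d})"
    by (intro exI[of _ "x 0 0"] exI[of _ "x 1 0"] exI[of _ "x 0 1"] exI[of _ "x 1 1"])
      (auto simp: ord)
next
  assume "\<exists>a b c d. A = {a, b, c, d} \<and> distinct [a, b, c, d] \<and>
     (\<forall>x\<in>A. \<forall>y\<in>A. lt r x y \<longleftrightarrow> x \<in> {a, b} \<and> y \<in> {c, d})"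
  then obtain a b c d where *: "A = {a, b, c, d} \<and> distinct [a, b, c, d] \<and>
     (\<forall>x\<in>A. \<forall>y\<in>A. lt r x y \<longleftrightarrow> x \<in> {a, b} \<and> y \<in> {c, d})"
    by (elim exE) (rule that)
  then have A: "A = {a, b, c, d}" and dist: "distinct [a, b, c, d]"
    and ord: "\<And>x y. x \<in> A \<Longrightarrow> y \<in> A \<Longrightarrow> lt r x y \<longleftrightarrow> x \<in> {a, b} \<and> y \<in> {c, d}"
    by simp_all
  define x where "x i j = (if j = 0 then if i = 0 then a else b else if i = 0 then c else d)"
    for i j :: nat
  have dom: "{..<2} \<times> {0, 1} = {(0::nat, 0::nat), (1, 0), (0, 1), (1, 1)}"
    by (auto simp: less_2_cases_iff)
  have bij: "bij_betw (\<lambda>(i, j). x i j) ({..<2} \<times> {0, 1}) A"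
    using dist unfolding bij_betw_def dom A inj_on_def by (simp add: x_def) auto
  have x_lt: "lt r (x i j) (x i' j') \<longleftrightarrow> j = 0 \<and> j' = 1 \<and> (i = i' \<or> i = (i' + 1) mod 2)"
    if "i < 2" "j \<in> {0, 1}" "i' < 2" "j' \<in> {0, 1}" for i j i' j'
  proof -
    have "x i j \<in> A" "x i' j' \<in> A" by (simp_all add: A x_def)
    moreover have "x i j \<in> {a, b} \<longleftrightarrow> j = 0" "x i' j' \<in> {c, d} \<longleftrightarrow> j' \<noteq> 0"
      using dist by (auto simp: x_def)
    moreover have "i = i' \<or> i = (i' + 1) mod 2" using that(1,3) by presburger
    ultimately show ?thesis using ord that(4) by auto
  qed
  have "\<forall>i<2. \<forall>j\<in>{0, 1}. \<forall>i'<2. \<forall>j'\<in>{0, 1}.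
      lt r (x i j) (x i' j') \<longleftrightarrow> j = 0 \<and> j' = 1 \<and> (i = i' \<or> i = (i' + 1) mod 2)"
    by (intro allI impI ballI) (rule x_lt)
  with bij have "\<exists>x :: nat \<Rightarrow> nat \<Rightarrow> 'a. bij_betw (\<lambda>(i, j). x i j) ({..<2} \<times> {0, 1}) A \<and>
    (\<forall>i<2. \<forall>j\<in>{0, 1}. \<forall>i'<2. \<forall>j'\<in>{0, 1}.
      lt r (x i j) (x i' j') \<longleftrightarrow> j = 0 \<and> j' = 1 \<and> (i = i' \<or> i = (i' + 1) mod 2))"
    by (intro exI[of _ x] conjI)
  then show "crown 2 r A" unfolding crown_def by (intro conjI order_refl)
qed

lemma tower_imp_four_crown_stack:
  assumes po: "partial_order_on P r" and tow: "pair_tower r m L" and sub: "(\<Union>i\<le>m. L i) \<subseteq> P"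
    and "m \<ge> 1"
  shows "four_crown_stack r (\<Union>i\<le>m. L i)"
proof -
  let ?R = "\<Union>i\<le>m. L i"
  note height = height_pair_tower[OF po tow sub]
  note level = level_pair_tower[OF po tow]
  have level2: "level2 r ?R k (k + 1) = L k \<union> L (k + 1)" if "k < m" for k
    using that by (simp add: level2_def level)
  have crown: "crown 2 r (L k \<union> L (k + 1))" if "k < m" for k
  proof -
    have "card (L k) = 2" "card (L (k + 1)) = 2"
      using tow that unfolding pair_tower_def by auto
    then obtain a b c d where ab: "L k = {a, b}" "a \<noteq> b" and cd: "L (k + 1) = {c, d}" "c \<noteq> d"
      by (auto simp: card_2_iff)
    have disj: "L k \<inter> L (k + 1) = {}"
      using pair_tower_disjoint[OF tow, of k "k + 1"] that by fastforce
    have "lt r x y \<longleftrightarrow> x \<in> L k \<and> y \<in> L (k + 1)"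
      if "x \<in> L k \<union> L (k + 1)" "y \<in> L k \<union> L (k + 1)" for x y
      using that \<open>k < m\<close> disj pair_tower_lt_iff[OF po tow, of k k x y]
        pair_tower_lt_iff[OF po tow, of k "k + 1" x y] pair_tower_lt_iff[OF po tow, of "k + 1" k x y]
        pair_tower_lt_iff[OF po tow, of "k + 1" "k + 1" x y]
      by auto
    then have "\<forall>x\<in>L k \<union> L (k + 1). \<forall>y\<in>L k \<union> L (k + 1). lt r x y \<longleftrightarrow> x \<in> {a, b} \<and> y \<in> {c, d}"
      unfolding ab(1)[symmetric] cd(1)[symmetric] by blast
    moreover have "L k \<union> L (k + 1) = {a, b, c, d}" using ab cd by auto
    moreover have "distinct [a, b, c, d]" using ab cd disj by auto
    ultimately show ?thesis unfolding crown_2_iff by blast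
  qed
  let ?G = "\<Union>k<m. r \<inter> (L k \<union> L (k + 1)) \<times> (L k \<union> L (k + 1))"
  have tr: "trans r" using po unfolding partial_order_on_def preorder_on_def by blast
  have "?G\<^sup>+ \<subseteq> r \<inter> ?R \<times> ?R"
  proof -
    have "trans (r \<inter> ?R \<times> ?R)"
      by (rule transI) (use transD[OF tr] in blast)
    then have id: "(r \<inter> ?R \<times> ?R)\<^sup>+ = r \<inter> ?R \<times> ?R" by (rule trancl_id)
    have "L k \<union> L (k + 1) \<subseteq> ?R" if "k < m" for k
      using that UN_upper[of k "{..m}" L] UN_upper[of "k + 1" "{..m}" L] by simp
    then have "?G \<subseteq> r \<inter> ?R \<times> ?R" by blast
    then have "?G\<^sup>+ \<subseteq> (r \<inter> ?R \<times> ?R)\<^sup>+" by (intro subrelI) (rule trancl_mono)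
    then show ?thesis unfolding id .
  qed
  moreover have "r \<inter> ?R \<times> ?R \<subseteq> ?G\<^sup>+"
  proof (rule subrelI)
    \<comment> \<open>Climb from \<open>x\<close> to \<open>y\<close> through one point of each storey in between.\<close>
    have up: "(x, y) \<in> ?G\<^sup>+" if "x \<in> L i" "y \<in> L (i + n + 1)" "i + n + 1 \<le> m" for x y i n
      using that(2,3)
    proof (induction n arbitrary: y)
      case 0
      then have "(x, y) \<in> ?G"
        using pair_tower_ltD[OF tow, of i "i + 1" x y] that(1)
        unfolding lt_def by (intro UN_I[of i]) auto
      then show ?case by (rule r_into_trancl)
    next
      case (Suc n)
      obtain z where z: "z \<in> L (i + n + 1)" using pair_tower_nonempty[OF tow] Suc.prems by fastforce
      have "(z, y) \<in> ?G"
        using pair_tower_ltD[OF tow, of "i + n + 1" "i + n + 2" z y] z Suc.prems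
        unfolding lt_def by (intro UN_I[of "i + n + 1"]) auto
      moreover have "(x, z) \<in> ?G\<^sup>+" using Suc.IH[OF z] Suc.prems(2) by simp
      ultimately show ?case by (rule trancl_into_trancl[rotated])
    qed
    fix x y assume "(x, y) \<in> r \<inter> ?R \<times> ?R"
    then obtain i j where ij: "(x, y) \<in> r" "i \<le> m" "j \<le> m" "x \<in> L i" "y \<in> L j" by blast
    show "(x, y) \<in> ?G\<^sup>+"
    proof (cases "x = y")
      case True
      \<comment> \<open>The storey \<open>i\<close> belongs to the pair of storeys that starts at \<open>i\<close>, or at \<open>i - 1\<close> when it is
        the top one.\<close>
      have "(x, y) \<in> ?G"
        using ij True \<open>m \<ge> 1\<close> by (intro UN_I[of "if i < m then i else i - 1"]) auto
      then show ?thesis by (rule r_into_trancl)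
    next
      case False
      then have "i < j" using ij pair_tower_lt_iff[OF po tow] unfolding lt_def by blast
      then obtain n where "j = i + n + 1" using less_iff_Suc_add by auto
      with up ij show ?thesis by blast
    qed
  qed
  ultimately have "r \<inter> ?R \<times> ?R = ?G\<^sup>+" by blast
  also have "?G = (\<Union>k<m. r \<inter> level2 r ?R k (k + 1) \<times> level2 r ?R k (k + 1))"
    using level2 by (intro SUP_cong) auto
  finally show ?thesis
    unfolding four_crown_stack_def height
    using crown level2 \<open>m \<ge> 1\<close> pair_tower_finite[OF tow] by auto
qed

text \<open>A point of the lower level of two cannot lie above a point of the higher one.  Hence in a
  4-crown on two consecutive levels the two bottom points form the lower level.\<close>

lemma crown_levels:
  assumes "crown 2 r (level2 r R k (k + 1))"
  shows "card (level r R k) = 2 \<and> card (level r R (k + 1)) = 2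
    \<and> set_lt r (level r R k) (level r R (k + 1))"
proof -
  let ?A = "level r R k" and ?B = "level r R (k + 1)"
  from assms obtain a b c d where AB: "?A \<union> ?B = {a, b, c, d}"
    and dist: "distinct [a, b, c, d]"
    and ord: "\<And>x y. \<lbrakk>x \<in> ?A \<union> ?B; y \<in> ?A \<union> ?B\<rbrakk> \<Longrightarrow> lt r x y \<longleftrightarrow> x \<in> {a, b} \<and> y \<in> {c, d}"
    unfolding crown_2_iff level2_def by metis
  have A: "?A = minimals r (R - (\<Union>i<k. level r R i))" by (rule level.simps)
  have B: "?B = minimals r (R - (\<Union>i<k. level r R i) - ?A)"
    by (subst level.simps) (simp add: lessThan_Suc Un_commute Diff_Un[symmetric] set_diff_eq conj_ac)
  have disj: "?A \<inter> ?B = {}" using B by (auto simp: minimals_def)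
  have no: "\<not> lt r x y" if "x \<in> ?A \<union> ?B" "y \<in> ?A" for x y
    using that A B by (auto simp: minimals_def)
  have noB: "\<not> lt r x y" if "x \<in> ?B" "y \<in> ?B" for x y
    using that B by (auto simp: minimals_def)
  have "c \<in> ?B" "d \<in> ?B" using no[of a] ord[of a] AB by blast+
  moreover have "a \<in> ?A" "b \<in> ?A"
    using noB[OF _ \<open>c \<in> ?B\<close>] ord[of _ c] AB by blast+
  ultimately have eq: "?A = {a, b}" "?B = {c, d}" using AB disj by auto
  show ?thesis unfolding set_lt_def using dist ord eq by auto
qed

lemma antichain_level: "antichain_in r (level r R k)"
  by (subst level.simps) (auto simp: antichain_in_def minimals_def)

lemma four_crown_stack_imp_tower:
  assumes po: "partial_order_on P r" and "R \<subseteq> P" and stack: "four_crown_stack r R"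
  shows "pair_tower r (height r R) (level r R) \<and> R = (\<Union>i\<le>height r R. level r R i)"
proof
  let ?h = "height r R"
  have h: "?h \<ge> 1" and crown: "\<And>k. k < ?h \<Longrightarrow> crown 2 r (level2 r R k (k + 1))"
    and gen: "r \<inter> R \<times> R = (\<Union>k<?h. r \<inter> level2 r R k (k + 1) \<times> level2 r R k (k + 1))\<^sup>+"
    using stack unfolding four_crown_stack_def by auto
  have card: "card (level r R i) = 2" if "i \<le> ?h" for i
    using that h crown_levels[OF crown, of i] crown_levels[OF crown, of "i - 1"]
    by (cases "i < ?h") auto
  have up: "set_lt r (level r R i) (level r R (i + n + 1))" if "i + n + 1 \<le> ?h" for i n
    using that
  proof (induction n)
    case 0
    then show ?case using crown_levels[OF crown, of i] by simp
  next
    case (Suc n)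
    obtain z where "z \<in> level r R (i + n + 1)" using card[of "i + n + 1"] Suc.prems by fastforce
    moreover have "set_lt r (level r R (i + n + 1)) (level r R (i + n + 1 + 1))"
      using crown_levels[OF crown, of "i + n + 1"] Suc.prems by simp
    ultimately show ?case using Suc lt_trans[OF po] unfolding set_lt_def
      by (metis Suc_leD add_Suc add_Suc_right Suc_eq_plus1)
  qed
  show "pair_tower r ?h (level r R)"
    unfolding pair_tower_def
    using card antichain_level up by (metis Suc_eq_plus1 add_Suc_right less_iff_Suc_add)
  show "R = (\<Union>i\<le>?h. level r R i)"
  proof
    show "R \<subseteq> (\<Union>i\<le>?h. level r R i)"
    proof
      \<comment> \<open>The pair \<open>(x, x)\<close> is generated by the crowns, so \<open>x\<close> lies in one of them.\<close>
      fix x assume "x \<in> R"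
      then have "(x, x) \<in> r \<inter> R \<times> R" using \<open>R \<subseteq> P\<close> le_iff_lt_or_eq[OF po] by blast
      then obtain y k where "k < ?h" "(x, y) \<in> level2 r R k (k + 1) \<times> level2 r R k (k + 1)"
        unfolding gen by (auto dest!: tranclD)
      then have "x \<in> level r R k \<or> x \<in> level r R (k + 1)" unfolding level2_def by blast
      with \<open>k < ?h\<close> show "x \<in> (\<Union>i\<le>?h. level r R i)"
        by (metis UN_I atMost_iff Suc_eq_plus1 Suc_leI less_imp_le)
    qed
    show "(\<Union>i\<le>?h. level r R i) \<subseteq> R"
    proof -
      have "level r R i \<subseteq> R" for i by (subst level.simps) (auto simp: minimals_def)
      then show ?thesis by blast
    qed
  qed
qed

lemma split_target_iff_tower:
  assumes po: "partial_order_on P r" and sub: "S \<subseteq> P"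
  shows "split_target r S \<longleftrightarrow> (\<exists>m L. pair_tower r m L \<and> S = (\<Union>i\<le>m. L i))"
proof
  assume "split_target r S"
  then consider "card S = 2" "antichain_in r S" | "four_crown_stack r S"
    unfolding split_target_def by blast
  then show "\<exists>m L. pair_tower r m L \<and> S = (\<Union>i\<le>m. L i)"
  proof cases
    case 1
    then show ?thesis by (intro exI[of _ 0] exI[of _ "\<lambda>_. S"]) (simp add: pair_tower_def)
  next
    case 2
    then show ?thesis using four_crown_stack_imp_tower[OF po sub] by blast
  qed
next
  assume "\<exists>m L. pair_tower r m L \<and> S = (\<Union>i\<le>m. L i)"
  then obtain m L where tow: "pair_tower r m L" "S = (\<Union>i\<le>m. L i)" by blast
  show "split_target r S"
  proof (cases m)
    case 0
    with tow show ?thesis by (simp add: split_target_def pair_tower_def)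
  next
    case (Suc n)
    with tow tower_imp_four_crown_stack[OF po tow(1)] sub show ?thesis
      by (simp add: split_target_def)
  qed
qed

text \<open>Only the top storey of \<open>A\<close> and the bottom storey of \<open>B\<close> are compared by hypothesis; every
  other comparison passes through a point of each of them.\<close>

lemma four_crown_stack_ordinal_sum:
  assumes po: "partial_order_on P r" and "A \<subseteq> P" "B \<subseteq> P" "split_target r A" "split_target r B"
    and lt: "set_lt r (level r A (height r A)) (level r B 0)"
  shows "four_crown_stack r (A \<union> B)"
proof -
  obtain m L where A: "pair_tower r m L" "A = (\<Union>i\<le>m. L i)"
    using split_target_iff_tower[OF po] assms by metis
  obtain n M where B: "pair_tower r n M" "B = (\<Union>i\<le>n. M i)"
    using split_target_iff_tower[OF po] assms by metis
  have lt0: "lt r y z" if "y \<in> L m" "z \<in> M 0" for y z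
    using lt that A B assms height_pair_tower[OF po A(1)] level_pair_tower[OF po A(1), of m]
      level_pair_tower[OF po B(1), of 0] unfolding set_lt_def by simp
  have lt1: "lt r x z" if "x \<in> L i" "i \<le> m" "z \<in> M 0" for x z i
  proof (cases "i = m")
    case False
    obtain y where "y \<in> L m" using pair_tower_nonempty[OF A(1)] by blast
    then have "lt r x y" using pair_tower_ltD[OF A(1), of i m x y] that False by simp
    with lt0 lt_trans[OF po] \<open>y \<in> L m\<close> that show ?thesis by blast
  qed (use lt0 that in blast)
  have lt2: "lt r x w" if "x \<in> L i" "i \<le> m" "w \<in> M j" "j \<le> n" for x w i j
  proof (cases "j = 0")
    case False
    obtain z where "z \<in> M 0" using pair_tower_nonempty[OF B(1)] by blast
    then have "lt r z w" using pair_tower_ltD[OF B(1), of 0 j z w] that False by simp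
    with lt1 lt_trans[OF po] \<open>z \<in> M 0\<close> that show ?thesis by blast
  qed (use lt1 that in blast)
  define K where "K i = (if i \<le> m then L i else M (i - (m + 1)))" for i
  have "pair_tower r (m + 1 + n) K"
    unfolding pair_tower_def
  proof (intro conjI allI impI)
    fix i assume "i \<le> m + 1 + n"
    then show "card (K i) = 2" "antichain_in r (K i)"
      using A(1) B(1) by (auto simp: K_def pair_tower_def)
  next
    fix i j assume ij: "j \<le> m + 1 + n" "i < j"
    consider "j \<le> m" | "i \<le> m" "\<not> j \<le> m" | "\<not> i \<le> m" by linarith
    then show "set_lt r (K i) (K j)"
    proof cases
      case 1
      then show ?thesis using ij A(1) by (simp add: K_def pair_tower_def)
    next
      case 2
      then show ?thesis using ij lt2[of _ i _ "j - (m + 1)"] by (auto simp: K_def set_lt_def)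
    next
      case 3
      then have "j - (m + 1) \<le> n" "i - (m + 1) < j - (m + 1)" using ij by auto
      with 3 ij show ?thesis using B(1) by (simp add: K_def pair_tower_def)
    qed
  qed
  moreover have "A \<union> B = (\<Union>i\<le>m + 1 + n. K i)"
  proof -
    have "L i = K i" if "i \<le> m" for i using that by (simp add: K_def)
    moreover have "M j = K (m + 1 + j)" for j by (simp add: K_def)
    ultimately have "A \<union> B = (\<Union>i\<le>m. K i) \<union> (\<Union>j\<le>n. K (m + 1 + j))"
      using A(2) B(2) by simp
    also have "\<dots> = (\<Union>i\<in>{..m} \<union> {m + 1..m + 1 + n}. K i)"
    proof -
      have "{m + 1..m + 1 + n} = (\<lambda>j. m + 1 + j) ` {..n}"
        using image_add_atLeastAtMost[of "m + 1" 0 n] by (simp add: atLeast0AtMost add.commute)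
      then show ?thesis by (simp add: UN_Un)
    qed
    also have "{..m} \<union> {m + 1..m + 1 + n} = {..m + 1 + n}" by auto
    finally show ?thesis .
  qed
  ultimately show ?thesis
    using tower_imp_four_crown_stack[OF po, of "m + 1 + n" K] assms by auto
qed

section \<open>Retractions onto towers\<close>

lemma retraction_ontoI:
  assumes "R \<subseteq> Q" "\<And>x. x \<in> Q \<Longrightarrow> f x \<in> R" "\<And>x. x \<in> R \<Longrightarrow> f x = x"
    "\<And>x y. \<lbrakk>x \<in> Q; y \<in> Q; (x, y) \<in> r\<rbrakk> \<Longrightarrow> (f x, f y) \<in> r"
  shows "retraction_onto r Q R f"
  unfolding retraction_onto_def monotone_on_def using assms by force

lemma retraction_ontoD:
  assumes "retraction_onto r Q R f"
  shows "R \<subseteq> Q" "x \<in> Q \<Longrightarrow> f x \<in> R" "x \<in> R \<Longrightarrow> f x = x"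
    "\<lbrakk>x \<in> Q; y \<in> Q; (x, y) \<in> r\<rbrakk> \<Longrightarrow> (f x, f y) \<in> r"
  using assms unfolding retraction_onto_def monotone_on_def by auto

lemma retraction_onto_restrict:
  assumes "retraction_onto r P R f" "Q \<subseteq> P" "f ` Q = S" "S \<subseteq> Q"
  shows "retraction_onto r Q S f"
  using assms unfolding retraction_onto_def monotone_on_def by blast

text \<open>The two modifications of \<open>f\<close> are made at once.  The bottom storey \<open>{a, b}\<close> is pushed down
  to minimal points \<open>a'\<close> and \<open>b'\<close> of \<open>P\<close>, which stay below all other storeys and are
  incomparable because they are minimal.  The minimal points that \<open>f\<close> sends higher are sent to
  \<open>a'\<close>.  Monotonicity of the new map only has to be checked at pairs \<open>x < y\<close>, where \<open>y\<close> is
  not minimal: either \<open>f y\<close> is in the bottom storey, and then \<open>f x = f y\<close>, or \<open>f y\<close>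
  is left as it is, and it lies above the new bottom storey and is at least \<open>f x\<close>.\<close>

lemma retraction_with_minimal_bottom:
  assumes po: "partial_order_on P r" and fin: "finite P"
    and stack: "four_crown_stack r R" and ret: "retraction_onto r P R f"
  obtains m L g where "m \<ge> 1" "pair_tower r m L" "retraction_onto r P (\<Union>i\<le>m. L i) g"
    "L 0 \<subseteq> minimals r P" "g ` minimals r P = L 0"
proof -
  note f = retraction_ontoD[OF ret]
  define m where "m = height r R"
  define L where "L = level r R"
  have tow: "pair_tower r m L" and R: "R = (\<Union>i\<le>m. L i)"
    using four_crown_stack_imp_tower[OF po f(1) stack] by (auto simp: m_def L_def)
  have "m \<ge> 1" using stack by (simp add: four_crown_stack_def m_def)
  obtain a b where ab: "L 0 = {a, b}" "a \<noteq> b"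
    using tow unfolding pair_tower_def by (auto simp: card_2_iff)
  \<comment> \<open>Within \<open>R\<close>, nothing lies strictly below \<open>L 0\<close>, and everything else lies above it.\<close>
  have bottom: "y = x" if "(y, x) \<in> r" "y \<in> R" "x \<in> L 0" for x y
  proof -
    obtain i where "i \<le> m" "y \<in> L i" using R \<open>y \<in> R\<close> by blast
    then show ?thesis using pair_tower_lt_iff[OF po tow, of i 0 y x] that by (auto simp: lt_def)
  qed
  have above: "lt r x y" if "x \<in> L 0" "y \<in> R" "y \<notin> L 0" for x y
  proof -
    obtain i where "i \<le> m" "y \<in> L i" using R \<open>y \<in> R\<close> by blast
    moreover from this have "i > 0" using that by (cases i) auto
    ultimately show ?thesis using pair_tower_ltD[OF tow] that by blast
  qed
  have aR: "a \<in> R" "b \<in> R" using R ab by auto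
  have ex: "\<exists>y\<in>minimals r P. (y, x) \<in> r \<and> f y = x" if "x \<in> L 0" for x
  proof -
    have "x \<in> R" using that R by blast
    then obtain y where y: "y \<in> minimals r P" "(y, x) \<in> r"
      using exists_minimal_below[OF po fin] f(1) by blast
    then have "y \<in> P" by (simp add: minimals_def)
    then have "(f y, x) \<in> r" "f y \<in> R" using f \<open>x \<in> R\<close> y by force+
    then show ?thesis using bottom that y by blast
  qed
  obtain a' where a': "a' \<in> minimals r P" "(a', a) \<in> r" "f a' = a" using ex ab by auto
  obtain b' where b': "b' \<in> minimals r P" "(b', b) \<in> r" "f b' = b" using ex ab by auto
  have min: "\<not> lt r y x" if "x \<in> minimals r P" "y \<in> P" for x y
    using that by (simp add: minimals_def)
  have inP: "a' \<in> P" "b' \<in> P" using a' b' by (auto simp: minimals_def)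
  have "a' \<noteq> b'" using a' b' ab by blast
  define M where "M = L(0 := {a', b'})"
  have above': "lt r x y" if "x \<in> {a', b'}" "y \<in> R" "y \<notin> L 0" for x y
  proof -
    have "lt r a y" "lt r b y" using above that ab by auto
    moreover have "lt r a' a \<or> a' = a" "lt r b' b \<or> b' = b" using a' b' by (auto simp: lt_def)
    ultimately show ?thesis using that(1) lt_trans[OF po] by blast
  qed
  have towM: "pair_tower r m M"
    unfolding pair_tower_def
  proof (intro conjI allI impI)
    fix i assume "i \<le> m"
    then show "card (M i) = 2" using tow \<open>a' \<noteq> b'\<close> by (simp add: M_def pair_tower_def)
    show "antichain_in r (M i)"
      using \<open>i \<le> m\<close> tow min a' b' inP
      by (cases "i = 0") (auto simp: M_def pair_tower_def antichain_in_def)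
  next
    fix i j assume ij: "j \<le> m" "i < j"
    show "set_lt r (M i) (M j)"
    proof (cases "i = 0")
      case True
      have "y \<in> R \<and> y \<notin> L 0" if "y \<in> L j" for y
        using that ij R pair_tower_disjoint[OF tow, of 0 j y] by auto
      with True ij above' show ?thesis by (auto simp: M_def set_lt_def)
    qed (use ij tow in \<open>simp add: M_def pair_tower_def\<close>)
  qed
  have UM: "(\<Union>i\<le>m. M i) = {a', b'} \<union> (R - L 0)"
  proof -
    have "{..m} = insert 0 {1..m}" by auto
    moreover have "L 0 \<inter> (\<Union>i\<in>{1..m}. L i) = {}"
      using pair_tower_disjoint[OF tow, of 0] by fastforce
    ultimately have "R - L 0 = (\<Union>i\<in>{1..m}. L i)" unfolding R by auto
    moreover have "(\<Union>i\<in>{1..m}. M i) = (\<Union>i\<in>{1..m}. L i)"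
      by (rule SUP_cong) (auto simp: M_def)
    moreover have "(\<Union>i\<le>m. M i) = M 0 \<union> (\<Union>i\<in>{1..m}. M i)"
      using \<open>{..m} = insert 0 {1..m}\<close> by simp
    moreover have "M 0 = {a', b'}" by (simp add: M_def)
    ultimately show ?thesis by (simp only:)
  qed
  define g where "g x = (if f x = b then b' else if f x = a \<or> x \<in> minimals r P then a' else f x)"
    for x
  have g_high: "g x = f x" if "x \<in> P" "f x \<notin> L 0" "x \<notin> minimals r P" for x
    using that ab by (simp add: g_def)
  have g_low: "g x \<in> {a', b'}" if "f x \<in> L 0 \<or> x \<in> minimals r P" for x
    using that ab by (auto simp: g_def)
  have newR: "{a', b'} \<union> (R - L 0) \<subseteq> P" using inP f(1) by blast
  have g_in: "g x \<in> {a', b'} \<union> (R - L 0)" if "x \<in> P" for x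
  proof (cases "f x \<in> L 0 \<or> x \<in> minimals r P")
    case True
    then show ?thesis using g_low by blast
  next
    case False
    then show ?thesis using g_high[OF that] f(2)[OF that] by auto
  qed
  have "retraction_onto r P (\<Union>i\<le>m. M i) g"
    unfolding UM
  proof (rule retraction_ontoI)
    show "{a', b'} \<union> (R - L 0) \<subseteq> P" by (fact newR)
    show "g x \<in> {a', b'} \<union> (R - L 0)" if "x \<in> P" for x using g_in that .
    show "g x = x" if "x \<in> {a', b'} \<union> (R - L 0)" for x
    proof (cases "x \<in> {a', b'}")
      case True
      then show ?thesis using a' b' ab by (auto simp: g_def)
    next
      case False
      then have x: "x \<in> R" "x \<notin> L 0" using that by auto
      \<comment> \<open>A point of a higher storey has \<open>a\<close> below it, so it is not redirected to \<open>a'\<close>.\<close>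
      then have "x \<notin> minimals r P" using above[of a x] ab min[of x a] aR f(1) by blast
      then show ?thesis using x f g_high by force
    qed
    fix x y assume xy: "x \<in> P" "y \<in> P" "(x, y) \<in> r"
    show "(g x, g y) \<in> r"
    proof (cases "x = y")
      case True
      then show ?thesis using subsetD[OF newR g_in[OF xy(1)]] le_iff_lt_or_eq[OF po] by simp
    next
      case False
      then have y: "y \<notin> minimals r P" using xy min unfolding lt_def by blast
      have fxy: "(f x, f y) \<in> r" "f x \<in> R" "f y \<in> R" using f xy by auto
      show ?thesis
      proof (cases "f y \<in> L 0")
        case True
        then have "f x = f y" using bottom fxy by blast
        with True ab have "g x = g y" by (auto simp: g_def)
        moreover have "g y \<in> P" using g_low True inP by blast
        ultimately show ?thesis using le_iff_lt_or_eq[OF po] by auto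
      next
        case False
        then have gy: "g y = f y" using g_high xy y by blast
        show ?thesis
        proof (cases "f x \<in> L 0 \<or> x \<in> minimals r P")
          case True
          then show ?thesis using above'[OF g_low] False fxy gy unfolding lt_def by auto
        next
          case False
          then show ?thesis using g_high xy gy fxy by auto
        qed
      qed
    qed
  qed
  moreover have "g ` minimals r P = M 0"
  proof -
    have "g a' = a'" "g b' = b'" using a' b' ab by (auto simp: g_def)
    then show ?thesis using g_low a' b' by (force simp: M_def)
  qed
  moreover have "M 0 \<subseteq> minimals r P" using a' b' by (simp add: M_def)
  ultimately show thesis using that \<open>m \<ge> 1\<close> towM by blast
qed

text \<open>The bottom storey serves as the lower target and the remaining storeys as the upper one.
  The points of \<open>P - min P\<close> that \<open>g\<close> sends to the bottom storey are put into \<open>D\<close>; they form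
  a down-set because \<open>g\<close> is monotone and the bottom storey is a down-set of the tower.\<close>

lemma down_split_of_retraction:
  assumes po: "partial_order_on P r" and fin: "finite P" and h: "height r P \<ge> 1"
    and stack: "four_crown_stack r R" and ret: "retraction_onto r P R f"
  shows "\<exists>D g S T.
     retractive_down_split r P 0 D g g \<and>
     S = g ` (levels r P 1 (height r P) - D) \<and> T = g ` levels r P 0 0 \<and>
     set_lt r (level r T (height r T)) (level r S 0) \<and>
     retraction_onto r P (T \<union> S) g"
proof -
  obtain m L g where "m \<ge> 1" and tow: "pair_tower r m L"
    and ret_g: "retraction_onto r P (\<Union>i\<le>m. L i) g"
    and low: "L 0 \<subseteq> minimals r P" "g ` minimals r P = L 0"
    using retraction_with_minimal_bottom[OF po fin stack ret] by metis
  note g = retraction_ontoD[OF ret_g]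
  let ?R = "\<Union>i\<le>m. L i"
  note lev0 = levels_0_0[of r P] and lev1 = levels_from_1[OF po fin]
  obtain n where m: "m = Suc n" using \<open>m \<ge> 1\<close> by (cases m) auto
  define S where "S = (\<Union>i\<le>n. L (Suc i))"
  define D where "D = {p \<in> P - minimals r P. g p \<in> L 0}"
  have R: "?R = L 0 \<union> S" unfolding S_def m by (auto simp: atMost_Suc_eq_insert_0)
  have disj: "L 0 \<inter> S = {}"
    unfolding S_def using pair_tower_disjoint[OF tow, of 0] m by fastforce
  have towS: "pair_tower r n (\<lambda>i. L (Suc i))"
    using tow unfolding pair_tower_def m by auto
  have towT: "pair_tower r 0 L" using tow unfolding pair_tower_def by auto
  have subP: "S \<subseteq> P" "L 0 \<subseteq> P" using g(1) R by auto
  have lt: "lt r x y" if xy: "x \<in> L 0" "y \<in> S" for x y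
    using xy pair_tower_ltD[OF tow, of 0 _ x y] m unfolding S_def by auto
  obtain z where z: "z \<in> L 0" using pair_tower_nonempty[OF tow] by blast
  have "S \<inter> minimals r P = {}"
    using lt[OF z] z subP unfolding minimals_def by blast
  then have S_high: "S \<subseteq> P - minimals r P - D"
    using subP g(3) R disj unfolding D_def by auto
  have gS: "g ` (P - minimals r P - D) = S"
  proof
    show "g ` (P - minimals r P - D) \<subseteq> S" using g(2) R unfolding D_def by blast
    show "S \<subseteq> g ` (P - minimals r P - D)" using S_high g(3) R by force
  qed
  have ret_s: "retraction_onto r (P - minimals r P - D) S g"
    using retraction_onto_restrict[OF ret_g _ gS S_high] by blast
  have ret_t: "retraction_onto r (minimals r P) (L 0) g"
    using retraction_onto_restrict[OF ret_g _ low(2,1)] by (simp add: minimals_def)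
  have "split_target r S" using split_target_iff_tower[OF po subP(1)] towS S_def by blast
  moreover have "split_target r (L 0)"
    using tow unfolding split_target_def pair_tower_def by simp
  moreover have "down_set_of r (P - minimals r P) D"
    unfolding down_set_of_def
  proof (intro conjI ballI impI)
    fix x y assume xy: "x \<in> D" "y \<in> P - minimals r P" "(y, x) \<in> r"
    then have le: "(g y, g x) \<in> r" "g x \<in> L 0" "g y \<in> ?R" using g(2,4) unfolding D_def by auto
    have "g y \<notin> S"
      using le lt[of "g x" "g y"] lt_asym[OF po lt, of "g x" "g y"] disj unfolding lt_def by auto
    then show "y \<in> D" using xy le R unfolding D_def by blast
  qed (auto simp: D_def)
  ultimately have split: "retractive_down_split r P 0 D g g"
    unfolding retractive_down_split_def lev0 using lev1 h ret_s ret_t by auto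
  have "level r (L 0) (height r (L 0)) = L 0"
    using height_pair_tower[OF po towT] level_pair_tower[OF po towT, of 0] subP by simp
  moreover have "level r S 0 = L 1"
    using level_pair_tower[OF po towS, of 0] by (simp add: S_def)
  moreover have "set_lt r (L 0) (L 1)" using tow m unfolding pair_tower_def by simp
  ultimately have "set_lt r (level r (L 0) (height r (L 0))) (level r S 0)" by simp
  then show ?thesis
    using split gS low ret_g R lev0 lev1
    by (intro exI[of _ D] exI[of _ g] exI[of _ S] exI[of _ "L 0"]) simp
qed

section \<open>Retracts and splits\<close>

theorem lemma3p10:
  fixes P :: "'a set" and r :: "'a rel"
  assumes "crowned_section r P"
  shows
    "(\<exists>R f. four_crown_stack r R \<and> retraction_onto r P R f) \<longleftrightarrow>
     (\<exists>k D s t S T.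
        retractive_down_split r P k D s t \<and>
        S = s ` (levels r P (k + 1) (height r P) - D) \<and>
        T = t ` levels r P 0 k \<and>
        set_lt r (level r T (height r T)) (level r S 0) \<and>
        (\<exists>g. retraction_onto r P (T \<union> S) g \<and>
             (\<forall>p \<in> levels r P (k + 1) (height r P) - D. g p = s p) \<and>
             (\<forall>p \<in> levels r P 0 k. g p = t p))) \<or>
     (\<exists>k U s t S T.
        retractive_up_split r P k U s t \<and>
        S = s ` (levels r P 0 (k - 1) - U) \<and>
        T = t ` levels r P k (height r P) \<and>
        set_lt r (level r S (height r S)) (level r T 0) \<and>
        (\<exists>g. retraction_onto r P (S \<union> T) g \<and>
             (\<forall>p \<in> levels r P 0 (k - 1) - U. g p = s p) \<and>
             (\<forall>p \<in> levels r P k (height r P). g p = t p)))"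
    (is "?retract \<longleftrightarrow> ?down \<or> ?up")
proof -
  have po: "partial_order_on P r" and fin: "finite P" and h: "height r P \<ge> 1"
    using assms unfolding crowned_section_def width_three_section_def by auto
  have sum: ?retract
    if "split_target r A" "split_target r B" "set_lt r (level r A (height r A)) (level r B 0)"
      "retraction_onto r P (A \<union> B) g" for A B g
    using four_crown_stack_ordinal_sum[OF po _ _ that(1,2,3)] that(4) retraction_ontoD(1)[OF that(4)]
    by blast
  show ?thesis
  proof
    assume ?retract
    then obtain R f where "four_crown_stack r R" "retraction_onto r P R f" by blast
    from down_split_of_retraction[OF po fin h this] obtain D g S T where
      *: "retractive_down_split r P 0 D g g"
      "S = g ` (levels r P 1 (height r P) - D)" "T = g ` levels r P 0 0"
      "set_lt r (level r T (height r T)) (level r S 0)" "retraction_onto r P (T \<union> S) g"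
      by blast
    have ?down
      by (rule exI[of _ 0], rule exI[of _ D], rule exI[of _ g], rule exI[of _ g],
          rule exI[of _ S], rule exI[of _ T]) (use * in auto)
    then show "?down \<or> ?up" ..
  next
    assume "?down \<or> ?up"
    then show ?retract
    proof
      assume ?down
      then obtain k D s t g where split: "retractive_down_split r P k D s t"
        and *: "set_lt r (level r (t ` levels r P 0 k) (height r (t ` levels r P 0 k)))
          (level r (s ` (levels r P (k + 1) (height r P) - D)) 0)"
          "retraction_onto r P (t ` levels r P 0 k \<union> s ` (levels r P (k + 1) (height r P) - D)) g"
        by blast
      from split have "split_target r (t ` levels r P 0 k)"
        "split_target r (s ` (levels r P (k + 1) (height r P) - D))"
        unfolding retractive_down_split_def retraction_onto_def by auto
      with * show ?retract using sum by blast
    next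
      assume ?up
      then obtain k U s t g where split: "retractive_up_split r P k U s t"
        and *: "set_lt r (level r (s ` (levels r P 0 (k - 1) - U))
            (height r (s ` (levels r P 0 (k - 1) - U)))) (level r (t ` levels r P k (height r P)) 0)"
          "retraction_onto r P (s ` (levels r P 0 (k - 1) - U) \<union> t ` levels r P k (height r P)) g"
        by blast
      from split have "split_target r (s ` (levels r P 0 (k - 1) - U))"
        "split_target r (t ` levels r P k (height r P))"
        unfolding retractive_up_split_def retraction_onto_def by auto
      with * show ?retract using sum by blast
    qed
  qed
qed

end
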